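(* Fix integers $n\ge 1$, $0\le m\le \binom{n}{2}$ and $k\ge 1$. Let $P$ and $Q$ be finite collections (multisets) of $n$-vertex graphs with $m$ edges. If $\Delta_kX_P=\Delta_kX_Q$, then $d_kX_P=d_kX_Q$. In particular, the $k$-edge deck of a graph can be reconstructed from its modified $k$-deck.
   Context: All graphs are simple, undirected, with $n$ vertices. $U_j$ denotes the set of all unlabelled $n$-vertex graphs with exactly $j$ edges. For a multiset $P$ of $m$-edge graphs, $X_P$ is its characteristic vector indexed by $U_m$ (the entry at $F\in U_m$ is the number of members of $P$ isomorphic to $F$). $\Delta_k$ is the square matrix indexed by $U_m$ whose $(a,b)$-entry is the number of ways to obtain a graph isomorphic to $G_a\in U_m$ from $G_b\in U_m$ by removing a set $A$ of $k$ edges of $G_b$ and then adding a set of $k$ edges not present in $G_b-A$ (added edges need not differ from removed ones); $\Delta_kX_G$ is the modified $k$-deck of $G$. $d_k$ is the matrix with rows indexed by $F_a\in U_{m-k}$ and columns by $G_b\in U_m$, whose $(a,b)$-entry is the number of $k$-edge subsets of $E(G_b)$ whose deletion yields a graph isomorphic to $F_a$; $d_kX_G$ is the $k$-edge deck of $G$. *)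

theory Defs
  imports Complex_Main "HOL-Library.Multiset" "HOL-Library.FuncSet"
begin

text \<open>A graph is a pair of a vertex set and a set of edges, an edge being a two-element set of
  vertices.\<close>

type_synonym 'a graph = "'a set \<times> 'a set set"

abbreviation verts :: "'a graph \<Rightarrow> 'a set" where
  "verts \<equiv> fst"

abbreviation edges :: "'a graph \<Rightarrow> 'a set set" where
  "edges \<equiv> snd"

definition vertex_pairs :: "'a set \<Rightarrow> 'a set set" where
  "vertex_pairs V = {e. e \<subseteq> V \<and> card e = 2}"

definition simple_graphs :: "nat \<Rightarrow> nat \<Rightarrow> 'a graph set" where
  "simple_graphs n j =
     {G. finite (verts G) \<and> card (verts G) = n \<and>
         edges G \<subseteq> vertex_pairs (verts G) \<and> card (edges G) = j}"

definition isomorphic :: "'a graph \<Rightarrow> 'b graph \<Rightarrow> bool" where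
  "isomorphic G H \<longleftrightarrow>
     (\<exists>f. bij_betw f (verts G) (verts H) \<and> (\<lambda>e. f ` e) ` edges G = edges H)"

text \<open>An unlabelled \<open>n\<close>-vertex graph is an isomorphism class of graphs on the vertex set
  \<open>{..<n}\<close>.  Every finite graph, over any type of vertices, is isomorphic to the members of
  exactly one such class.\<close>

type_synonym ugraph = "nat graph set"

definition unlabelled :: "nat \<Rightarrow> nat \<Rightarrow> ugraph set" where
  "unlabelled n j =
     {G \<in> simple_graphs n j. verts G = {..<n}} //
     {(G, H). G \<in> simple_graphs n j \<and> verts G = {..<n} \<and>
              H \<in> simple_graphs n j \<and> verts H = {..<n} \<and> isomorphic G H}"

text \<open>The matrix entries below are counted on a chosen representative; the counts do not depend
  on the choice.\<close>

definition rep :: "ugraph \<Rightarrow> nat graph" where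
  "rep F = (SOME G. G \<in> F)"

definition char_vec :: "nat \<Rightarrow> nat \<Rightarrow> 'a graph multiset \<Rightarrow> ugraph \<Rightarrow> nat" where
  "char_vec n m P = (\<lambda>F \<in> unlabelled n m. size {#G \<in># P. isomorphic G (rep F)#})"

text \<open>A way to perform the modification is a pair \<open>(A, B)\<close> of the removed and the added set;
  the two sets may overlap.\<close>

definition Delta :: "nat \<Rightarrow> ugraph \<Rightarrow> ugraph \<Rightarrow> nat" where
  "Delta k a b =
     (let V = verts (rep b); E = edges (rep b) in
      card {(A, B). A \<subseteq> E \<and> card A = k \<and>
                    B \<subseteq> vertex_pairs V - (E - A) \<and> card B = k \<and>
                    isomorphic (V, (E - A) \<union> B) (rep a)})"

definition edge_deletion :: "nat \<Rightarrow> ugraph \<Rightarrow> ugraph \<Rightarrow> nat" where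
  "edge_deletion k a b =
     (let V = verts (rep b); E = edges (rep b) in
      card {A. A \<subseteq> E \<and> card A = k \<and> isomorphic (V, E - A) (rep a)})"

text \<open>Vectors with index set \<open>R\<close> are extensional functions, i.e. constantly \<open>undefined\<close>
  outside \<open>R\<close>, so that equality of functions is equality of all entries indexed by \<open>R\<close>.\<close>

definition mat_vec :: "'r set \<Rightarrow> 'c set \<Rightarrow> ('r \<Rightarrow> 'c \<Rightarrow> nat) \<Rightarrow> ('c \<Rightarrow> nat) \<Rightarrow> 'r \<Rightarrow> nat" where
  "mat_vec R C M x = (\<lambda>a \<in> R. \<Sum>b\<in>C. M a b * x b)"

definition Delta_times :: "nat \<Rightarrow> nat \<Rightarrow> nat \<Rightarrow> (ugraph \<Rightarrow> nat) \<Rightarrow> ugraph \<Rightarrow> nat" where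
  "Delta_times n m k = mat_vec (unlabelled n m) (unlabelled n m) (Delta k)"

text \<open>For \<open>k > m\<close> the subtraction \<open>m - k\<close> is truncated to \<open>0\<close>.  No \<open>k\<close>-edge subset exists in
  that case, so the matrix is zero and the equality of two products carries no information, just
  as for a matrix without rows.\<close>

definition d_times :: "nat \<Rightarrow> nat \<Rightarrow> nat \<Rightarrow> (ugraph \<Rightarrow> nat) \<Rightarrow> ugraph \<Rightarrow> nat" where
  "d_times n m k = mat_vec (unlabelled n (m - k)) (unlabelled n m) (edge_deletion k)"

definition modified_deck :: "nat \<Rightarrow> nat \<Rightarrow> nat \<Rightarrow> 'a graph \<Rightarrow> ugraph \<Rightarrow> nat" where
  "modified_deck n m k G = Delta_times n m k (char_vec n m {#G#})"

definition edge_deck :: "nat \<Rightarrow> nat \<Rightarrow> nat \<Rightarrow> 'a graph \<Rightarrow> ugraph \<Rightarrow> nat" where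
  "edge_deck n m k G = d_times n m k (char_vec n m {#G#})"

end

theory Submission
  imports Defs
begin

text \<open>Spread a vector \<open>z\<close> on unlabelled graphs evenly over the labelled graphs on \<open>{..<n}\<close>, by
  \<open>y G = z [G] / card [G]\<close>, and let \<open>g F\<close> be the sum of \<open>y G\<close> over the labelled \<open>m\<close>-edge graphs
  \<open>G\<close> containing \<open>F\<close>.  Then the entry of \<open>d\<^sub>k z\<close> at a class \<open>f\<close> is the sum of \<open>g\<close> over \<open>f\<close>, while
  pairing \<open>\<Delta>\<^sub>k z\<close> with \<open>y\<close> gives the sum of all \<open>(g F)\<^sup>2\<close>.  So \<open>\<Delta>\<^sub>k z = 0\<close> forces \<open>g = 0\<close> and hence
  \<open>d\<^sub>k z = 0\<close>; this is applied to a difference of two vectors.\<close>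

section \<open>Isomorphism invariance of the counts\<close>

lemma finite_vertex_pairs: "finite V \<Longrightarrow> finite (vertex_pairs V)"
  unfolding vertex_pairs_def by (rule finite_subset[of _ "Pow V"]) auto

lemma bij_betw_vertex_pairs:
  assumes "bij_betw f V W"
  shows "bij_betw (image f) (vertex_pairs V) (vertex_pairs W)"
  unfolding bij_betw_def
proof
  have inj: "inj_on f V" and W: "f ` V = W"
    using assms by (auto simp: bij_betw_def)
  show "inj_on (image f) (vertex_pairs V)"
    by (rule inj_on_subset[OF inj_on_image_Pow[OF inj]]) (auto simp: vertex_pairs_def)
  show "image f ` vertex_pairs V = vertex_pairs W"
  proof
    show "image f ` vertex_pairs V \<subseteq> vertex_pairs W"
      using W by (auto simp: vertex_pairs_def card_image inj_on_subset[OF inj])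
    show "vertex_pairs W \<subseteq> image f ` vertex_pairs V"
    proof
      fix e assume e: "e \<in> vertex_pairs W"
      then obtain d where d: "d \<subseteq> V" "e = f ` d"
        using W by (auto simp: vertex_pairs_def subset_image_iff)
      then have "card d = 2"
        using e by (simp add: vertex_pairs_def card_image inj_on_subset[OF inj])
      with d show "e \<in> image f ` vertex_pairs V" by (auto simp: vertex_pairs_def)
    qed
  qed
qed

lemma isomorphic_refl: "isomorphic G G"
  unfolding isomorphic_def by (intro exI[of _ id]) auto

lemma isomorphic_trans:
  assumes "isomorphic G H" "isomorphic H K"
  shows "isomorphic G K"
proof -
  from assms obtain f g where
    f: "bij_betw f (verts G) (verts H)" "image f ` edges G = edges H" and
    g: "bij_betw g (verts H) (verts K)" "image g ` edges H = edges K"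
    by (auto simp: isomorphic_def)
  have "image (g \<circ> f) ` edges G = image g ` image f ` edges G"
    by (simp only: image_image o_def)
  then have "image (g \<circ> f) ` edges G = edges K"
    unfolding f(2) g(2) .
  then show ?thesis
    unfolding isomorphic_def using bij_betw_trans[OF f(1) g(1)] by blast
qed

text \<open>The inverse bijection undoes \<open>f\<close> only on subsets of \<open>verts G\<close>.
  Nothing is known about how \<open>f\<close> acts outside the vertex set, so the edges of
  \<open>G\<close> have to lie inside it.\<close>

lemma isomorphic_sym:
  assumes "isomorphic G H" and G: "edges G \<subseteq> vertex_pairs (verts G)"
  shows "isomorphic H G"
proof -
  from assms obtain f where
    f: "bij_betw f (verts G) (verts H)" "image f ` edges G = edges H"
    by (auto simp: isomorphic_def)
  let ?g = "inv_into (verts G) f"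
  have "?g ` f ` e = e" if "e \<in> edges G" for e
    by (rule inv_into_image_cancel) (use f that G in \<open>auto simp: bij_betw_def vertex_pairs_def\<close>)
  then have "image ?g ` edges H = edges G"
    unfolding f(2)[symmetric] image_image[of "image ?g"] by simp
  then show ?thesis
    unfolding isomorphic_def using bij_betw_inv_into[OF f(1)] by blast
qed

section \<open>Transport of deletions and modifications along an isomorphism\<close>

definition deletion_ways :: "nat \<Rightarrow> 'a graph \<Rightarrow> 'b graph \<Rightarrow> 'a set set set" where
  "deletion_ways k G K = {A. A \<subseteq> edges G \<and> card A = k \<and> isomorphic (verts G, edges G - A) K}"

definition modification_ways :: "nat \<Rightarrow> 'a graph \<Rightarrow> 'b graph \<Rightarrow> ('a set set \<times> 'a set set) set" where
  "modification_ways k G K =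
     {(A, B). A \<subseteq> edges G \<and> card A = k \<and>
              B \<subseteq> vertex_pairs (verts G) - (edges G - A) \<and> card B = k \<and>
              isomorphic (verts G, (edges G - A) \<union> B) K}"

lemma finite_deletion_ways: "finite (edges G) \<Longrightarrow> finite (deletion_ways k G K)"
  unfolding deletion_ways_def by (rule finite_subset[of _ "Pow (edges G)"]) auto

lemma finite_modification_ways:
  "finite (edges G) \<Longrightarrow> finite (verts G) \<Longrightarrow> finite (modification_ways k G K)"
  unfolding modification_ways_def
  by (rule finite_subset[of _ "Pow (edges G) \<times> Pow (vertex_pairs (verts G))"])
     (auto simp: finite_vertex_pairs)

text \<open>From here on only the induced map \<open>h\<close> on vertex pairs matters, not the
  vertex bijection. The isomorphism in the last clause points back to \<open>G\<close>, so that it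
  composes with one from \<open>(verts G, X)\<close> to a target graph.\<close>

lemma isomorphic_induced_map:
  assumes "isomorphic G H"
  obtains h where "bij_betw h (vertex_pairs (verts G)) (vertex_pairs (verts H))"
    "h ` edges G = edges H"
    "\<And>X. X \<subseteq> vertex_pairs (verts G) \<Longrightarrow> isomorphic (verts H, h ` X) (verts G, X)"
proof -
  from assms obtain f where
    f: "bij_betw f (verts G) (verts H)" "image f ` edges G = edges H"
    by (auto simp: isomorphic_def)
  have "isomorphic (verts H, image f ` X) (verts G, X)" if "X \<subseteq> vertex_pairs (verts G)" for X
    by (rule isomorphic_sym) (use f that in \<open>auto simp: isomorphic_def\<close>)
  then show thesis
    using that[OF bij_betw_vertex_pairs[OF f(1)] f(2)] by blast
qed

text \<open>Applying \<open>h\<close> to the removed and added sets is injective and keeps the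
  isomorphism type of the result, so the ways for \<open>G\<close> embed into those for
  \<open>H\<close>. One inequality suffices, since symmetry of isomorphism will supply the
  other.\<close>

lemma card_ways_le:
  assumes iso: "isomorphic G H" and fin: "finite (verts H)"
    and G: "edges G \<subseteq> vertex_pairs (verts G)" and H: "edges H \<subseteq> vertex_pairs (verts H)"
  shows "card (deletion_ways k G K) \<le> card (deletion_ways k H K)"
    and "card (modification_ways k G K) \<le> card (modification_ways k H K)"
proof -
  obtain h where bij: "bij_betw h (vertex_pairs (verts G)) (vertex_pairs (verts H))"
    and E: "h ` edges G = edges H"
    and hiso: "\<And>X. X \<subseteq> vertex_pairs (verts G) \<Longrightarrow> isomorphic (verts H, h ` X) (verts G, X)"
    using isomorphic_induced_map[OF iso] by blast
  let ?N = "vertex_pairs (verts G)"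
  have inj: "inj_on h ?N" and N: "h ` ?N = vertex_pairs (verts H)"
    using bij by (auto simp: bij_betw_def)
  have injh: "inj_on (image h) (Pow ?N)"
    by (rule inj_on_image_Pow[OF inj])
  have diff: "h ` (X - Y) = h ` X - h ` Y" if "X \<subseteq> ?N" "Y \<subseteq> ?N" for X Y
    by (rule inj_on_image_set_diff[OF inj]) (use that in auto)
  have card: "card (h ` X) = card X" if "X \<subseteq> ?N" for X
    by (rule card_image[OF inj_on_subset[OF inj that]])
  have trans: "isomorphic (verts H, h ` X) K" if "X \<subseteq> ?N" "isomorphic (verts G, X) K" for X
    using isomorphic_trans[OF hiso] that by blast
  have finE: "finite (edges H)"
    using finite_subset[OF H] fin finite_vertex_pairs by blast
  show "card (deletion_ways k G K) \<le> card (deletion_ways k H K)"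
  proof (rule card_inj_on_le)
    show "inj_on (image h) (deletion_ways k G K)"
      by (rule inj_on_subset[OF injh]) (use G in \<open>auto simp: deletion_ways_def\<close>)
    show "image h ` deletion_ways k G K \<subseteq> deletion_ways k H K"
    proof (rule image_subsetI)
      fix A assume "A \<in> deletion_ways k G K"
      then have A: "A \<subseteq> edges G" "card A = k" "isomorphic (verts G, edges G - A) K"
        by (auto simp: deletion_ways_def)
      have "h ` (edges G - A) = edges H - h ` A"
        using diff[of "edges G" A] A G E by auto
      moreover have "isomorphic (verts H, h ` (edges G - A)) K"
        by (rule trans) (use A G in auto)
      moreover have "h ` A \<subseteq> edges H"
        using A(1) E by blast
      moreover have "card (h ` A) = k"
        using A G card[of A] by auto
      ultimately show "h ` A \<in> deletion_ways k H K"
        by (simp add: deletion_ways_def)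
    qed
  qed (rule finite_deletion_ways[OF finE])
  show "card (modification_ways k G K) \<le> card (modification_ways k H K)"
  proof (rule card_inj_on_le)
    show "inj_on (map_prod (image h) (image h)) (modification_ways k G K)"
      by (rule inj_on_subset[OF map_prod_inj_on[OF injh injh]])
         (use G in \<open>auto simp: modification_ways_def\<close>)
    show "map_prod (image h) (image h) ` modification_ways k G K \<subseteq> modification_ways k H K"
    proof (rule image_subsetI, clarify)
      fix A B assume "(A, B) \<in> modification_ways k G K"
      then have A: "A \<subseteq> edges G" "card A = k" and B: "B \<subseteq> ?N - (edges G - A)" "card B = k"
        and AB: "isomorphic (verts G, (edges G - A) \<union> B) K"
        by (auto simp: modification_ways_def)
      have hA: "h ` (edges G - A) = edges H - h ` A"
        using diff[of "edges G" A] A G E by auto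
      have "h ` B \<subseteq> h ` (?N - (edges G - A))"
        using B by blast
      also have "\<dots> = vertex_pairs (verts H) - (edges H - h ` A)"
        using diff[of ?N "edges G - A"] G N hA by auto
      finally have "h ` B \<subseteq> vertex_pairs (verts H) - (edges H - h ` A)" .
      moreover have "isomorphic (verts H, h ` ((edges G - A) \<union> B)) K"
        by (rule trans) (use A B AB G in auto)
      moreover have "h ` A \<subseteq> edges H"
        using A(1) E by blast
      moreover have "A \<subseteq> ?N" "B \<subseteq> ?N"
        using A(1) B(1) G by auto
      then have "card (h ` A) = k" "card (h ` B) = k"
        using A(2) B(2) card by simp_all
      ultimately show "map_prod (image h) (image h) (A, B) \<in> modification_ways k H K"
        by (simp add: modification_ways_def image_Un hA)
    qed
  qed (rule finite_modification_ways[OF finE fin])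
qed

text \<open>Frees the matrix entries from the chosen representative: the count may be made on any
  member of a class.\<close>

lemma card_ways_cong:
  assumes iso: "isomorphic G H" and GH: "G \<in> simple_graphs n i" "H \<in> simple_graphs n j"
  shows "card (deletion_ways k G K) = card (deletion_ways k H K)"
    and "card (modification_ways k G K) = card (modification_ways k H K)"
proof -
  have *: "finite (verts G)" "finite (verts H)"
    "edges G \<subseteq> vertex_pairs (verts G)" "edges H \<subseteq> vertex_pairs (verts H)"
    using GH by (auto simp: simple_graphs_def)
  note iso' = isomorphic_sym[OF iso *(3)]
  show "card (deletion_ways k G K) = card (deletion_ways k H K)"
    "card (modification_ways k G K) = card (modification_ways k H K)"
    using card_ways_le[OF iso *(2,3,4)] card_ways_le[OF iso' *(1,4,3)] by (meson le_antisym)+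
qed

section \<open>Passage to labelled graphs\<close>

definition labelled :: "nat \<Rightarrow> nat \<Rightarrow> nat graph set" where
  "labelled n j = {G \<in> simple_graphs n j. verts G = {..<n}}"

definition iso_rel :: "nat \<Rightarrow> nat \<Rightarrow> (nat graph \<times> nat graph) set" where
  "iso_rel n j = {(G, H). G \<in> labelled n j \<and> H \<in> labelled n j \<and> isomorphic G H}"

lemma unlabelled_eq: "unlabelled n j = labelled n j // iso_rel n j"
  by (simp add: unlabelled_def labelled_def iso_rel_def conj_ac)

lemma labelled_iff:
  "G \<in> labelled n j \<longleftrightarrow>
     verts G = {..<n} \<and> edges G \<subseteq> vertex_pairs {..<n} \<and> card (edges G) = j"
  by (auto simp: labelled_def simple_graphs_def)

lemma finite_edges_labelled: "G \<in> labelled n j \<Longrightarrow> finite (edges G)"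
  by (metis finite_lessThan finite_subset finite_vertex_pairs labelled_iff)

lemma finite_labelled: "finite (labelled n j)"
  by (rule finite_subset[of _ "{{..<n}} \<times> Pow (vertex_pairs {..<n})"])
     (auto simp: labelled_iff finite_vertex_pairs)

lemma equiv_iso_rel: "equiv (labelled n j) (iso_rel n j)"
proof (rule equivI)
  show "iso_rel n j \<subseteq> labelled n j \<times> labelled n j"
    by (auto simp: iso_rel_def)
  show "refl_on (labelled n j) (iso_rel n j)"
    by (auto simp: refl_on_def iso_rel_def isomorphic_refl)
  show "sym (iso_rel n j)"
    unfolding sym_def iso_rel_def using isomorphic_sym by (fastforce simp: labelled_iff)
  show "trans (iso_rel n j)"
    unfolding trans_def iso_rel_def using isomorphic_trans by blast
qed

lemma rep_in: "a \<in> unlabelled n j \<Longrightarrow> rep a \<in> a"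
  unfolding unlabelled_eq rep_def
  using in_quotient_imp_non_empty[OF equiv_iso_rel, of a n j] by (auto intro: someI_ex)

lemma unlabelled_subset: "a \<in> unlabelled n j \<Longrightarrow> a \<subseteq> labelled n j"
  unfolding unlabelled_eq by (rule in_quotient_imp_subset[OF equiv_iso_rel])

text \<open>Turns the isomorphism tests against \<open>rep\<close> in the matrix entries into
  membership in a class, so that counts of ways become counts of labelled graphs.\<close>

lemma isomorphic_rep_iff:
  assumes "a \<in> unlabelled n j" "G \<in> labelled n j"
  shows "isomorphic G (rep a) \<longleftrightarrow> G \<in> a"
proof -
  have r: "rep a \<in> a" "rep a \<in> labelled n j"
    using rep_in unlabelled_subset assms by blast+
  have a: "a \<in> labelled n j // iso_rel n j"
    using assms by (simp add: unlabelled_eq)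
  have "isomorphic G (rep a) \<longleftrightarrow> (G, rep a) \<in> iso_rel n j"
    using assms r by (simp add: iso_rel_def)
  also have "\<dots> \<longleftrightarrow> G \<in> a"
  proof
    assume "(G, rep a) \<in> iso_rel n j"
    then have "(rep a, G) \<in> iso_rel n j"
      using equiv_iso_rel by (meson equivE symD)
    then show "G \<in> a"
      by (rule in_quotient_imp_closed[OF equiv_iso_rel a r(1)])
  next
    assume "G \<in> a"
    then show "(G, rep a) \<in> iso_rel n j"
      using in_quotient_imp_in_rel[OF equiv_iso_rel a] r(1) by simp
  qed
  finally show ?thesis .
qed

text \<open>Deleting \<open>A\<close> from the fixed graph \<open>G\<close> amounts to choosing the
  labelled subgraph \<open>F\<close> with edge set \<open>edges G - A\<close>, and \<open>A\<close>
  is recovered as \<open>edges G - edges F\<close>. For \<open>k > m\<close> the truncated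
  \<open>m - k\<close> would be \<open>0\<close> and the edgeless graph would be counted on the
  right; hence \<open>k \<le> m\<close>.\<close>

lemma edge_deletion_eq_sum:
  assumes f: "f \<in> unlabelled n (m - k)" and b: "b \<in> unlabelled n m" and G: "G \<in> b" and k: "k \<le> m"
  shows "edge_deletion k f b = (\<Sum>F\<in>f. of_bool (edges F \<subseteq> edges G))"
proof -
  have GL: "G \<in> labelled n m" and bL: "rep b \<in> labelled n m"
    using rep_in unlabelled_subset b G by blast+
  have fL: "f \<subseteq> labelled n (m - k)" by (rule unlabelled_subset[OF f])
  have V: "verts G = {..<n}" and E: "edges G \<subseteq> vertex_pairs {..<n}" "card (edges G) = m"
    using GL by (auto simp: labelled_iff)
  have finE: "finite (edges G)" by (rule finite_edges_labelled[OF GL])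
  have finf: "finite f" using finite_subset[OF fL finite_labelled] .
  have "edge_deletion k f b = card (deletion_ways k (rep b) (rep f))"
    by (simp add: edge_deletion_def deletion_ways_def Let_def)
  also have "\<dots> = card (deletion_ways k G (rep f))"
    using card_ways_cong(1)[of G "rep b"] isomorphic_rep_iff[OF b GL] G GL bL
    by (metis (no_types, lifting) labelled_def mem_Collect_eq)
  also have "\<dots> = card {F \<in> f. edges F \<subseteq> edges G}"
  proof (rule bij_betw_same_card)
    have *: "(verts G, edges G - A) \<in> labelled n (m - k)" if "A \<subseteq> edges G" "card A = k" for A
      using that V E finE by (auto simp: labelled_iff card_Diff_subset finite_subset)
    show "bij_betw (\<lambda>A. (verts G, edges G - A)) (deletion_ways k G (rep f)) {F \<in> f. edges F \<subseteq> edges G}"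
    proof (rule bij_betw_byWitness[where f' = "\<lambda>F. edges G - edges F"])
      show "\<forall>F\<in>{F \<in> f. edges F \<subseteq> edges G}. (verts G, edges G - (edges G - edges F)) = F"
        using fL V by (auto simp: labelled_iff double_diff subset_iff prod_eq_iff)
      show "(\<lambda>A. (verts G, edges G - A)) ` deletion_ways k G (rep f) \<subseteq> {F \<in> f. edges F \<subseteq> edges G}"
        using * isomorphic_rep_iff[OF f] by (auto simp: deletion_ways_def)
      show "(\<lambda>F. edges G - edges F) ` {F \<in> f. edges F \<subseteq> edges G} \<subseteq> deletion_ways k G (rep f)"
      proof clarify
        fix F assume F: "F \<in> f" "edges F \<subseteq> edges G"
        then have FL: "F \<in> labelled n (m - k)" using fL by blast
        then have "card (edges G - edges F) = k"
          using F E finE k by (simp add: labelled_iff card_Diff_subset finite_subset[OF F(2)])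
        moreover have "(verts G, edges G - (edges G - edges F)) = F"
          using FL F V by (auto simp: labelled_iff prod_eq_iff)
        ultimately show "edges G - edges F \<in> deletion_ways k G (rep f)"
          using F isomorphic_rep_iff[OF f FL] by (auto simp: deletion_ways_def)
      qed
    qed (auto simp: deletion_ways_def)
  qed
  also have "\<dots> = (\<Sum>F\<in>f. of_bool (edges F \<subseteq> edges G))"
    using finf by (simp add: of_bool_def sum.If_cases Int_def)
  finally show ?thesis .
qed

text \<open>A modification passes through \<open>F\<close>, which is \<open>G\<close> without
  \<open>A\<close>, and ends in \<open>H\<close>, which is \<open>F\<close> with \<open>B\<close>
  added; \<open>(A, B)\<close> and \<open>(H, F)\<close> determine each other. Since
  \<open>B\<close> may meet \<open>A\<close>, every \<open>H\<close> in \<open>a\<close> containing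
  \<open>F\<close> arises. The inner sum is therefore an entry of the Gram matrix of the containment
  relation between labelled graphs with \<open>m - k\<close> and with \<open>m\<close> edges, which
  is the source of positivity.\<close>

lemma Delta_eq_sum:
  assumes a: "a \<in> unlabelled n m" and b: "b \<in> unlabelled n m" and G: "G \<in> b" and k: "k \<le> m"
  shows "Delta k a b =
    (\<Sum>H\<in>a. \<Sum>F\<in>labelled n (m - k). of_bool (edges F \<subseteq> edges G) * of_bool (edges F \<subseteq> edges H))"
proof -
  have GL: "G \<in> labelled n m" and bL: "rep b \<in> labelled n m"
    using rep_in unlabelled_subset b G by blast+
  have aL: "a \<subseteq> labelled n m" by (rule unlabelled_subset[OF a])
  have V: "verts G = {..<n}" and E: "edges G \<subseteq> vertex_pairs {..<n}" "card (edges G) = m"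
    using GL by (auto simp: labelled_iff)
  have finE: "finite (edges G)" by (rule finite_edges_labelled[OF GL])
  have finN: "finite (vertex_pairs {..<n})" by (simp add: finite_vertex_pairs)
  have fina: "finite a" using finite_subset[OF aL finite_labelled] .
  let ?S = "{(H, F). H \<in> a \<and> F \<in> labelled n (m - k) \<and> edges F \<subseteq> edges G \<and> edges F \<subseteq> edges H}"
  have "Delta k a b = card (modification_ways k (rep b) (rep a))"
    by (simp add: Delta_def modification_ways_def Let_def)
  also have "\<dots> = card (modification_ways k G (rep a))"
    using card_ways_cong(2)[of G "rep b"] isomorphic_rep_iff[OF b GL] G GL bL
    by (metis (no_types, lifting) labelled_def mem_Collect_eq)
  also have "\<dots> = card ?S"
  proof (rule bij_betw_same_card)
    let ?to = "\<lambda>(A, B). ((verts G, (edges G - A) \<union> B), (verts G, edges G - A))"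
    let ?from = "\<lambda>(H, F). (edges G - edges F, edges H - edges F)"
    show "bij_betw ?to (modification_ways k G (rep a)) ?S"
    proof (rule bij_betw_byWitness[where f' = ?from])
      show "\<forall>x\<in>modification_ways k G (rep a). ?from (?to x) = x"
        by (auto simp: modification_ways_def)
      show "\<forall>x\<in>?S. ?to (?from x) = x"
        using aL V by (auto simp: labelled_iff prod_eq_iff subset_iff)
      show "?to ` modification_ways k G (rep a) \<subseteq> ?S"
      proof (rule image_subsetI)
        fix x assume "x \<in> modification_ways k G (rep a)"
        then obtain A B where x: "x = (A, B)" and A: "A \<subseteq> edges G" "card A = k" and B: "B \<subseteq> vertex_pairs {..<n} - (edges G - A)" "card B = k"
          and AB: "isomorphic (verts G, (edges G - A) \<union> B) (rep a)"
          using V by (auto simp: modification_ways_def)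
        have c: "card (edges G - A) = m - k"
          using A E finE by (simp add: card_Diff_subset finite_subset[OF A(1)])
        have "finite B" using B finN by (meson finite_Diff finite_subset)
        \<comment> \<open>\<open>B\<close> avoids \<open>edges G - A\<close>, so the sizes add up to
          \<open>m - k + k\<close>, which is \<open>m\<close> because
          \<open>k \<le> m\<close>.\<close>
        then have "card ((edges G - A) \<union> B) = m"
          using B c finE k by (subst card_Un_disjoint) auto
        then have "(verts G, (edges G - A) \<union> B) \<in> labelled n m"
          using V E B by (auto simp: labelled_iff)
        moreover have "(verts G, edges G - A) \<in> labelled n (m - k)"
          using V E c by (auto simp: labelled_iff)
        ultimately show "?to x \<in> ?S"
          using AB isomorphic_rep_iff[OF a] x by auto
      qed
      show "?from ` ?S \<subseteq> modification_ways k G (rep a)"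
      proof (rule image_subsetI)
        fix x assume "x \<in> ?S"
        then obtain H F where x: "x = (H, F)" and H: "H \<in> a" and FL: "F \<in> labelled n (m - k)"
          and F: "edges F \<subseteq> edges G" "edges F \<subseteq> edges H"
          by auto
        have HL: "H \<in> labelled n m" using H aL by blast
        have "card (edges G - edges F) = k" "card (edges H - edges F) = k"
          using F FL HL E finE k
          by (simp_all add: labelled_iff card_Diff_subset finite_subset[OF F(1)])
        moreover have "edges G - (edges G - edges F) = edges F" using F by auto
        moreover have "(verts G, edges F \<union> (edges H - edges F)) = H"
          using HL F V by (auto simp: labelled_iff prod_eq_iff)
        ultimately show "?from x \<in> modification_ways k G (rep a)"
          using H HL isomorphic_rep_iff[OF a HL] V x
          by (auto simp: modification_ways_def labelled_iff)
      qed
    qed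
  qed
  also have "card ?S = card (Sigma a (\<lambda>H. {F \<in> labelled n (m - k). edges F \<subseteq> edges G \<and> edges F \<subseteq> edges H}))"
    by (rule arg_cong[of _ _ card]) auto
  also have "\<dots> = (\<Sum>H\<in>a. \<Sum>F\<in>labelled n (m - k). of_bool (edges F \<subseteq> edges G \<and> edges F \<subseteq> edges H))"
    using fina finite_labelled[of n "m - k"]
    by (simp add: card_SigmaI of_bool_def sum.If_cases Int_def)
  finally show ?thesis by (simp add: of_bool_conj)
qed

section \<open>The kernel of the modification matrix\<close>

lemma sum_quotient:
  assumes "equiv S R" "finite S"
  shows "(\<Sum>a\<in>S // R. \<Sum>x\<in>a. f x) = (\<Sum>x\<in>S. f x)"
proof -
  have "(\<Sum>x\<in>\<Union>(S // R). f x) = (\<Sum>a\<in>S // R. \<Sum>x\<in>a. f x)"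
  proof (subst sum.Union_disjoint)
    show "\<forall>A\<in>S // R. finite A"
      using in_quotient_imp_subset[OF assms(1)] assms(2) by (meson finite_subset)
    show "\<forall>A\<in>S // R. \<forall>B\<in>S // R. A \<noteq> B \<longrightarrow> A \<inter> B = {}"
      using quotient_disj[OF assms(1)] by blast
  qed simp
  then show ?thesis using Union_quotient[OF assms(1)] by simp
qed

text \<open>The vector \<open>z\<close> is real because it will be a difference of two vectors of
  natural numbers and gets divided by class sizes.\<close>

lemma Delta_kernel_subset:
  fixes z :: "ugraph \<Rightarrow> real"
  assumes k: "k \<le> m" and f: "f \<in> unlabelled n (m - k)"
    and zero: "\<And>a. a \<in> unlabelled n m \<Longrightarrow> (\<Sum>b\<in>unlabelled n m. real (Delta k a b) * z b) = 0"
  shows "(\<Sum>b\<in>unlabelled n m. real (edge_deletion k f b) * z b) = 0"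
proof -
  let ?U = "unlabelled n m" and ?L = "labelled n m" and ?T = "labelled n (m - k)"
  let ?i = "\<lambda>F G. of_bool (edges F \<subseteq> edges G) :: real"
  \<comment> \<open>Dividing by the class size makes the values of \<open>y\<close> on a class
    \<open>b\<close> add up to \<open>z b\<close>.\<close>
  define y where "y G = z (iso_rel n m `` {G}) / real (card (iso_rel n m `` {G}))" for G
  define g where "g F = (\<Sum>G\<in>?L. ?i F G * y G)" for F
  have finL: "finite ?L" and finT: "finite ?T" by (rule finite_labelled)+
  have sumU: "(\<Sum>b\<in>?U. \<Sum>G\<in>b. h G) = (\<Sum>G\<in>?L. h G)" for h :: "nat graph \<Rightarrow> real"
    unfolding unlabelled_eq by (rule sum_quotient[OF equiv_iso_rel finL])
  have y: "y G = z b / real (card b)" if "b \<in> ?U" "G \<in> b" for b G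
  proof -
    have "iso_rel n m `` {G} = b"
      using that unfolding unlabelled_eq
      by (metis Image_singleton_iff equiv_class_eq[OF equiv_iso_rel] quotientE)
    then show ?thesis by (simp add: y_def)
  qed
  \<comment> \<open>If the coefficient of \<open>z b\<close> can be computed as \<open>h G\<close>
    from every member \<open>G\<close> of \<open>b\<close>, the sum over classes becomes a sum over
    labelled graphs. Both matrix products are rewritten in this way.\<close>
  have spread: "(\<Sum>b\<in>?U. real (c b) * z b) = (\<Sum>G\<in>?L. h G * y G)"
    if c: "\<And>b G. b \<in> ?U \<Longrightarrow> G \<in> b \<Longrightarrow> real (c b) = h G" for c :: "ugraph \<Rightarrow> nat" and h
  proof -
    have "(\<Sum>G\<in>b. h G * y G) = real (c b) * z b" if b: "b \<in> ?U" for b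
    proof -
      have "finite b" using finite_subset[OF unlabelled_subset[OF b] finL] .
      then have "card b \<noteq> 0" using rep_in[OF b] by auto
      moreover have "(\<Sum>G\<in>b. h G * y G) = (\<Sum>G\<in>b. real (c b) * (z b / real (card b)))"
        by (rule sum.cong) (use c y b in auto)
      ultimately show ?thesis by simp
    qed
    then show ?thesis using sumU[of "\<lambda>G. h G * y G"] by simp
  qed
  \<comment> \<open>Summing over \<open>G\<close> innermost produces \<open>g\<close>: each
    \<open>H\<close> in \<open>a\<close> contributes the total of \<open>g\<close> over its labelled
    subgraphs with \<open>m - k\<close> edges.\<close>
  have Delta: "(\<Sum>b\<in>?U. real (Delta k a b) * z b) = (\<Sum>H\<in>a. \<Sum>F\<in>?T. ?i F H * g F)"
    if a: "a \<in> ?U" for a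
  proof -
    have "(\<Sum>b\<in>?U. real (Delta k a b) * z b)
        = (\<Sum>G\<in>?L. (\<Sum>H\<in>a. \<Sum>F\<in>?T. ?i F G * ?i F H) * y G)"
    proof (rule spread)
      fix b G assume "b \<in> ?U" "G \<in> b"
      from Delta_eq_sum[OF a this k]
      show "real (Delta k a b) = (\<Sum>H\<in>a. \<Sum>F\<in>?T. ?i F G * ?i F H)" by simp
    qed
    also have "\<dots> = (\<Sum>H\<in>a. \<Sum>G\<in>?L. \<Sum>F\<in>?T. ?i F G * ?i F H * y G)"
      unfolding sum_distrib_right by (rule sum.swap)
    also have "\<dots> = (\<Sum>H\<in>a. \<Sum>F\<in>?T. \<Sum>G\<in>?L. ?i F G * ?i F H * y G)"
      by (rule sum.cong[OF refl], rule sum.swap)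
    also have "\<dots> = (\<Sum>H\<in>a. \<Sum>F\<in>?T. ?i F H * g F)"
      unfolding g_def sum_distrib_left by (intro sum.cong refl) (simp add: mult_ac)
    finally show ?thesis .
  qed
  \<comment> \<open>Only one factor of the square is expanded by the definition of \<open>g\<close>.
    The other is kept, so that exchanging the sums reproduces the right-hand side of
    \<open>Delta\<close>.\<close>
  have "(g F)\<^sup>2 = (\<Sum>H\<in>?L. y H * (?i F H * g F))" for F
  proof -
    have "(\<Sum>H\<in>?L. y H * (?i F H * g F)) = (\<Sum>H\<in>?L. ?i F H * y H) * g F"
      unfolding sum_distrib_right by (rule sum.cong) auto
    then show ?thesis by (simp only: g_def[symmetric] power2_eq_square)
  qed
  then have "(\<Sum>F\<in>?T. (g F)\<^sup>2) = (\<Sum>F\<in>?T. \<Sum>H\<in>?L. y H * (?i F H * g F))"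
    by (rule sum.cong[OF refl])
  also have "\<dots> = (\<Sum>H\<in>?L. y H * (\<Sum>F\<in>?T. ?i F H * g F))"
    unfolding sum_distrib_left by (rule sum.swap)
  also have "\<dots> = (\<Sum>a\<in>?U. \<Sum>H\<in>a. y H * (\<Sum>F\<in>?T. ?i F H * g F))"
    by (rule sumU[symmetric])
  \<comment> \<open>On a class \<open>y\<close> is constant and can be pulled out; what remains is
    the entry at \<open>a\<close> of the product with \<open>Delta k\<close>, which
    vanishes.\<close>
  also have "\<dots> = (\<Sum>a\<in>?U. z a / real (card a) * (\<Sum>H\<in>a. \<Sum>F\<in>?T. ?i F H * g F))"
  proof (rule sum.cong[OF refl])
    fix a assume a: "a \<in> ?U"
    show "(\<Sum>H\<in>a. y H * (\<Sum>F\<in>?T. ?i F H * g F))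
        = z a / real (card a) * (\<Sum>H\<in>a. \<Sum>F\<in>?T. ?i F H * g F)"
      unfolding sum_distrib_left[of _ _ a] by (rule sum.cong) (simp_all only: y[OF a])
  qed
  also have "\<dots> = 0"
    using Delta zero by (intro sum.neutral) simp
  finally have "\<forall>F\<in>?T. (g F)\<^sup>2 = 0"
    using finT by (subst (asm) sum_nonneg_eq_0_iff) auto
  then have g: "g F = 0" if "F \<in> f" for F
    using that unlabelled_subset[OF f] by auto
  \<comment> \<open>The entry at \<open>f\<close> involves \<open>g\<close> only at the members of
    \<open>f\<close>, where it is now known to vanish.\<close>
  have "(\<Sum>b\<in>?U. real (edge_deletion k f b) * z b) = (\<Sum>G\<in>?L. (\<Sum>F\<in>f. ?i F G) * y G)"
  proof (rule spread)
    fix b G assume "b \<in> ?U" "G \<in> b"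
    from edge_deletion_eq_sum[OF f this k]
    show "real (edge_deletion k f b) = (\<Sum>F\<in>f. ?i F G)" by simp
  qed
  also have "\<dots> = (\<Sum>F\<in>f. g F)"
    unfolding g_def sum_distrib_right by (rule sum.swap)
  also have "\<dots> = 0"
    by (intro sum.neutral ballI g)
  finally show ?thesis .
qed

section \<open>From the kernel to the decks\<close>

lemma edge_deletion_eq_0:
  assumes "b \<in> unlabelled n m" "m < k"
  shows "edge_deletion k f b = 0"
proof -
  have bL: "rep b \<in> labelled n m"
    using rep_in unlabelled_subset assms by blast
  have "card A \<noteq> k" if "A \<subseteq> edges (rep b)" for A
    using card_mono[OF finite_edges_labelled[OF bL] that] bL assms by (simp add: labelled_iff)
  then have "{A. A \<subseteq> edges (rep b) \<and> card A = k \<and>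
      isomorphic (verts (rep b), edges (rep b) - A) (rep f)} = {}"
    by blast
  then show ?thesis unfolding edge_deletion_def Let_def by (simp only: card.empty)
qed

text \<open>Arbitrary vectors are allowed, not only characteristic ones, so that a deck can later be
  reconstructed from any preimage of the modified deck.\<close>

lemma d_times_eq_if_Delta_times_eq:
  assumes eq: "Delta_times n m k x = Delta_times n m k x'"
  shows "d_times n m k x = d_times n m k x'"
  unfolding d_times_def mat_vec_def
proof (rule restrict_ext)
  fix f assume f: "f \<in> unlabelled n (m - k)"
  let ?U = "unlabelled n m"
  show "(\<Sum>b\<in>?U. edge_deletion k f b * x b) = (\<Sum>b\<in>?U. edge_deletion k f b * x' b)"
  proof (cases "k \<le> m")
    case False
    then show ?thesis by (simp add: edge_deletion_eq_0)
  next
    case True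
    \<comment> \<open>The difference is formed in the reals, as subtraction on \<open>nat\<close>
      truncates.\<close>
    have sub: "(\<Sum>b\<in>?U. real (c b) * (real (x b) - real (x' b)))
        = real (\<Sum>b\<in>?U. c b * x b) - real (\<Sum>b\<in>?U. c b * x' b)" for c :: "ugraph \<Rightarrow> nat"
      by (simp add: right_diff_distrib sum_subtractf)
    have "(\<Sum>b\<in>?U. real (edge_deletion k f b) * (real (x b) - real (x' b))) = 0"
    proof (rule Delta_kernel_subset[OF True f])
      fix a assume "a \<in> ?U"
      then have "(\<Sum>b\<in>?U. Delta k a b * x b) = (\<Sum>b\<in>?U. Delta k a b * x' b)"
        using fun_cong[OF eq, of a] by (simp add: Delta_times_def mat_vec_def)
      then show "(\<Sum>b\<in>?U. real (Delta k a b) * (real (x b) - real (x' b))) = 0"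
        unfolding sub by simp
    qed
    then show ?thesis unfolding sub by (simp only: right_minus_eq of_nat_eq_iff)
  qed
qed

theorem theorem2p6:
  fixes n m k :: nat
  assumes "n \<ge> 1" and "m \<le> n choose 2" and "k \<ge> 1"
  shows "(\<forall>(P :: 'a graph multiset) (Q :: 'b graph multiset).
            set_mset P \<subseteq> simple_graphs n m \<longrightarrow> set_mset Q \<subseteq> simple_graphs n m \<longrightarrow>
            Delta_times n m k (char_vec n m P) = Delta_times n m k (char_vec n m Q) \<longrightarrow>
            d_times n m k (char_vec n m P) = d_times n m k (char_vec n m Q)) \<and>
         (\<exists>reconstruct. \<forall>G :: 'a graph. G \<in> simple_graphs n m \<longrightarrow>
            edge_deck n m k G = reconstruct (modified_deck n m k G))"
proof (intro conjI allI impI d_times_eq_if_Delta_times_eq)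
  \<comment> \<open>The first conjunct has been reduced to its own hypothesis. For the second, any
    vector with the given image under \<open>Delta_times\<close> may be chosen, since all of them
    have the same image under \<open>d_times\<close>.\<close>
  let ?reconstruct = "\<lambda>v. d_times n m k (SOME x. Delta_times n m k x = v)"
  have "edge_deck n m k G = ?reconstruct (modified_deck n m k G)" for G :: "'a graph"
    unfolding edge_deck_def modified_deck_def
    \<comment> \<open>The vector \<open>char_vec n m {#G#}\<close> itself witnesses that the choice
      is possible.\<close>
    by (rule d_times_eq_if_Delta_times_eq[symmetric]) (rule someI[of "\<lambda>x. Delta_times n m k x = _"], rule refl)
  then show "\<exists>reconstruct. \<forall>G :: 'a graph. G \<in> simple_graphs n m \<longrightarrow>
      edge_deck n m k G = reconstruct (modified_deck n m k G)"
    by (intro exI[of _ ?reconstruct]) simp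
qed

end
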